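(* Let $\mathbf{s}\in\mathcal{S}$ be the true state. If the network is series-parallel, then for any rest point $(\bar\theta,\bar w)$, $$C(\bar w)\ \ge\ C(w^{\mathbf{s}*}).$$
   Context: Network and states. A finite directed graph with a single origin-destination pair has edge set $\mathcal{E}$ and nonempty set $\mathcal{R}$ of routes (simple directed paths from origin to destination). $\mathcal{S}$ is a finite set of states and $\Delta(\mathcal{S})$ is the set of probability vectors on $\mathcal{S}$; $\mathbf{s}\in\mathcal{S}$ denotes the true state. For each $e\in\mathcal{E}$, $s\in\mathcal{S}$ there is an edge cost function $\ell_e^s:[0,\infty)\to\mathbb{R}$, continuous and strictly increasing, differentiable on $(0,\infty)$, and there is a constant $\alpha>0$ with $\frac{d\ell_e^s(w_e)}{dw_e}\ge\alpha$ for all $e\in\mathcal{E}$, $s\in\mathcal{S}$, $w_e>0$. Series-parallel. The network is series-parallel if it has no embedded Wheatstone network; equivalently, as a two-terminal (origin-destination) network in which every edge lies on a route, it can be built recursively from single edges (directed from origin to destination) by connecting two series-parallel networks in series (identifying the destination of the first with the origin of the second) or in parallel (identifying the two origins and the two destinations). Strategies and equilibrium. The total demand of nonatomic travelers is $D>0$. The feasible strategy set is $Q=\{q=(q_r)_{r\in\mathcal{R}}: q_r\ge 0,\ \sum_{r\in\mathcal{R}}q_r=D\}$. A strategy $q\in Q$ induces the edge load vector $w=(w_e)_{e\in\mathcal{E}}$, $w_e=\sum_{r\ni e}q_r$. The cost of route $r$ in state $s$ is $\ell_r^s(q)=\sum_{e\in r}\ell_e^s(w_e)$, and its expected cost under belief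 $\theta\in\Delta(\mathcal{S})$ is $\mathbb{E}_\theta[\ell_r^s(q)]=\sum_{s\in\mathcal{S}}\theta(s)\ell_r^s(q)$. A strategy $q^*\in Q$ is a Wardrop equilibrium corresponding to $\theta$ if for all $r\in\mathcal{R}$: $q_r^*>0\Rightarrow \mathbb{E}_\theta[\ell_r^s(q^* )]=\min_{r'\in\mathcal{R}}\mathbb{E}_\theta[\ell_{r'}^s(q^* )]$. For each $\theta$, all Wardrop equilibria induce the same edge load vector, called the equilibrium edge load vector corresponding to $\theta$. The complete information equilibrium edge load vector $w^{s*}$ in state $s$ is the one corresponding to the belief assigning probability 1 to $s$. Rest points. For an edge load vector $w$, $\mathcal{S}^\dagger(w)$ is the set of states $s\in\mathcal{S}$ for which there exists $e\in\mathcal{E}$ with $w_e>0$ and $\ell_e^s(w_e)\ne\ell_e^{\mathbf{s}}(w_e)$. A rest point is a pair $(\bar\theta,\bar w)$ with $\bar\theta\in\Delta(\mathcal{S})$ such that $\bar w$ is the equilibrium edge load vector corresponding to $\bar\theta$ and $\bar\theta(s)=0$ for all $s\in\mathcal{S}^\dagger(\bar w)$. Cost. For an edge load vector $w$, $C(w)=\sum_{e\in\mathcal{E}}w_e\,\ell_e^{\mathbf{s}}(w_e)$ (the travelers' cost in the true state). *)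

theory Defs
  imports Complex_Main "Graph_Theory.Arc_Walk" "Graph_Theory.Digraph_Component"
begin

text \<open>Multigraphs are used because a series-parallel network may have parallel edges.\<close>

definition routes :: "('v, 'e) pre_digraph \<Rightarrow> 'v \<Rightarrow> 'v \<Rightarrow> 'e list set" where
  "routes G u v = {r. pre_digraph.apath G u r v}"


subsection \<open>Series-parallel networks\<close>

text \<open>
  The components of a connection are taken to be subgraphs that already share exactly the
  terminals to be identified, so that connecting them is taking their union.
\<close>

inductive sp_network :: "('v, 'e) pre_digraph \<Rightarrow> 'v \<Rightarrow> 'v \<Rightarrow> bool" where
  single:
    "\<lbrakk> u \<noteq> v; verts G = {u, v}; arcs G = {e}; tail G e = u; head G e = v \<rbrakk>
     \<Longrightarrow> sp_network G u v"
| series: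
    "\<lbrakk> sp_network G u m; sp_network H m v; compatible G H;
       verts G \<inter> verts H = {m}; arcs G \<inter> arcs H = {} \<rbrakk>
     \<Longrightarrow> sp_network (union G H) u v"
| parallel:
    "\<lbrakk> sp_network G u v; sp_network H u v; compatible G H;
       verts G \<inter> verts H = {u, v}; arcs G \<inter> arcs H = {} \<rbrakk>
     \<Longrightarrow> sp_network (union G H) u v"

definition route_subnetwork :: "('v, 'e) pre_digraph \<Rightarrow> 'v \<Rightarrow> 'v \<Rightarrow> ('v, 'e) pre_digraph" where
  "route_subnetwork G u v =
     \<lparr> verts = (\<Union>r\<in>routes G u v. set (pre_digraph.awalk_verts G u r)),
       arcs = (\<Union>r\<in>routes G u v. set r),
       tail = tail G, head = head G \<rparr>"

text \<open>
  The recursive construction describes networks in which every edge lies on a route; in general,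
  edges and vertices on no route are discarded first.  If every edge and vertex of \<^term>\<open>G\<close> lies
  on a route, then \<^term>\<open>route_subnetwork G u v\<close> is \<^term>\<open>G\<close> itself.
\<close>

definition series_parallel :: "('v, 'e) pre_digraph \<Rightarrow> 'v \<Rightarrow> 'v \<Rightarrow> bool" where
  "series_parallel G u v \<longleftrightarrow> sp_network (route_subnetwork G u v) u v"


subsection \<open>Strategies and Wardrop equilibria\<close>

definition beliefs :: "'s set \<Rightarrow> ('s \<Rightarrow> real) set" where
  "beliefs S = {\<theta>. (\<forall>s\<in>S. 0 \<le> \<theta> s) \<and> (\<Sum>s\<in>S. \<theta> s) = 1}"

definition certain :: "'s \<Rightarrow> 's \<Rightarrow> real" where
  "certain s = (\<lambda>s'. if s' = s then 1 else 0)"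

text \<open>
  Strategies are indexed by routes: values of \<open>q\<close> outside \<^term>\<open>routes G u v\<close> are unconstrained
  and never used.  Similarly, an edge load vector is a function considered only on
  \<^term>\<open>arcs G\<close>.
\<close>

definition strategies :: "('v, 'e) pre_digraph \<Rightarrow> 'v \<Rightarrow> 'v \<Rightarrow> real \<Rightarrow> ('e list \<Rightarrow> real) set" where
  "strategies G u v D =
     {q. (\<forall>r\<in>routes G u v. 0 \<le> q r) \<and> (\<Sum>r\<in>routes G u v. q r) = D}"

definition load :: "('v, 'e) pre_digraph \<Rightarrow> 'v \<Rightarrow> 'v \<Rightarrow> ('e list \<Rightarrow> real) \<Rightarrow> 'e \<Rightarrow> real" where
  "load G u v q e = (\<Sum>r | r \<in> routes G u v \<and> e \<in> set r. q r)"

definition route_cost ::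
  "('v, 'e) pre_digraph \<Rightarrow> 'v \<Rightarrow> 'v \<Rightarrow> ('e \<Rightarrow> 's \<Rightarrow> real \<Rightarrow> real)
    \<Rightarrow> 's \<Rightarrow> ('e list \<Rightarrow> real) \<Rightarrow> 'e list \<Rightarrow> real" where
  "route_cost G u v c s q r = (\<Sum>e\<in>set r. c e s (load G u v q e))"

definition expected_route_cost ::
  "('v, 'e) pre_digraph \<Rightarrow> 'v \<Rightarrow> 'v \<Rightarrow> 's set \<Rightarrow> ('e \<Rightarrow> 's \<Rightarrow> real \<Rightarrow> real)
    \<Rightarrow> ('s \<Rightarrow> real) \<Rightarrow> ('e list \<Rightarrow> real) \<Rightarrow> 'e list \<Rightarrow> real" where
  "expected_route_cost G u v S c \<theta> q r = (\<Sum>s\<in>S. \<theta> s * route_cost G u v c s q r)"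

definition wardrop_equilibrium ::
  "('v, 'e) pre_digraph \<Rightarrow> 'v \<Rightarrow> 'v \<Rightarrow> real \<Rightarrow> 's set \<Rightarrow> ('e \<Rightarrow> 's \<Rightarrow> real \<Rightarrow> real)
    \<Rightarrow> ('s \<Rightarrow> real) \<Rightarrow> ('e list \<Rightarrow> real) \<Rightarrow> bool" where
  "wardrop_equilibrium G u v D S c \<theta> q \<longleftrightarrow>
     q \<in> strategies G u v D \<and>
     (\<forall>r\<in>routes G u v. 0 < q r \<longrightarrow>
        expected_route_cost G u v S c \<theta> q r =
        Min (expected_route_cost G u v S c \<theta> q ` routes G u v))"

definition equilibrium_load ::
  "('v, 'e) pre_digraph \<Rightarrow> 'v \<Rightarrow> 'v \<Rightarrow> real \<Rightarrow> 's set \<Rightarrow> ('e \<Rightarrow> 's \<Rightarrow> real \<Rightarrow> real)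
    \<Rightarrow> ('s \<Rightarrow> real) \<Rightarrow> ('e \<Rightarrow> real) \<Rightarrow> bool" where
  "equilibrium_load G u v D S c \<theta> w \<longleftrightarrow>
     (\<exists>q. wardrop_equilibrium G u v D S c \<theta> q \<and> (\<forall>e\<in>arcs G. w e = load G u v q e))"


subsection \<open>Rest points and cost; \<open>s0\<close> is the true state\<close>

definition distinguished_states ::
  "('v, 'e) pre_digraph \<Rightarrow> 's set \<Rightarrow> ('e \<Rightarrow> 's \<Rightarrow> real \<Rightarrow> real) \<Rightarrow> 's \<Rightarrow> ('e \<Rightarrow> real) \<Rightarrow> 's set" where
  "distinguished_states G S c s0 w = {s\<in>S. \<exists>e\<in>arcs G. 0 < w e \<and> c e s (w e) \<noteq> c e s0 (w e)}"

definition rest_point ::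
  "('v, 'e) pre_digraph \<Rightarrow> 'v \<Rightarrow> 'v \<Rightarrow> real \<Rightarrow> 's set \<Rightarrow> ('e \<Rightarrow> 's \<Rightarrow> real \<Rightarrow> real) \<Rightarrow> 's
    \<Rightarrow> ('s \<Rightarrow> real) \<Rightarrow> ('e \<Rightarrow> real) \<Rightarrow> bool" where
  "rest_point G u v D S c s0 \<theta> w \<longleftrightarrow>
     \<theta> \<in> beliefs S \<and> equilibrium_load G u v D S c \<theta> w \<and>
     (\<forall>s\<in>distinguished_states G S c s0 w. \<theta> s = 0)"

definition total_cost ::
  "('v, 'e) pre_digraph \<Rightarrow> ('e \<Rightarrow> 's \<Rightarrow> real \<Rightarrow> real) \<Rightarrow> 's \<Rightarrow> ('e \<Rightarrow> real) \<Rightarrow> real" where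
  "total_cost G c s0 w = (\<Sum>e\<in>arcs G. w e * c e s0 (w e))"

end

theory Submission
  imports Defs
begin

text \<open>
  At a rest point every edge in use has the same cost in the true state as in each state that
  still has positive belief, so expected and true costs agree on edges in use, and the total
  cost is \<open>D\<close> times the common cost of the cheapest routes.  In a series-parallel
  network, some cheapest route uses only edges that are in use at the rest point and carry at
  least their complete information load.  Its true cost can only fall when the loads are
  replaced by the complete information loads, which bounds the complete information equilibrium
  route cost from above.
\<close>

subsection \<open>Dominating routes\<close>

text \<open>Stated for a bare set of edge lists, so that it applies to either part of a connection
  without mentioning graphs. On \<open>routes G u v\<close> it is \<open>load\<close>.\<close>

definition route_load :: "'e list set \<Rightarrow> ('e list \<Rightarrow> real) \<Rightarrow> 'e \<Rightarrow> real" where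
  "route_load R q e = (\<Sum>r | r \<in> R \<and> e \<in> set r. q r)"

text \<open>The weights \<open>k\<close> are fixed numbers that do not react to the flow. In the
  application they are edge costs frozen at the equilibrium loads, which turns the Wardrop condition
  into shortness of every route in use.\<close>

definition shortest :: "('e \<Rightarrow> real) \<Rightarrow> 'e list set \<Rightarrow> 'e list \<Rightarrow> bool" where
  "shortest k R r \<longleftrightarrow> r \<in> R \<and> (\<forall>r'\<in>R. sum k (set r) \<le> sum k (set r'))"

text \<open>
  The route found may itself carry no flow under \<open>q\<close>, although all its edges do;
  this is why it is required to be shortest.
\<close>

definition dominating :: "'e list set \<Rightarrow> bool" where
  "dominating R \<longleftrightarrow>
     (\<forall>k q q'. (\<forall>r\<in>R. 0 \<le> q r) \<longrightarrow> (\<forall>r\<in>R. 0 \<le> q' r) \<longrightarrow>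
        (\<forall>r\<in>R. 0 < q r \<longrightarrow> shortest k R r) \<longrightarrow>
        sum q' R \<le> sum q R \<longrightarrow> 0 < sum q R \<longrightarrow>
        (\<exists>r. shortest k R r \<and>
          (\<forall>e\<in>set r. 0 < route_load R q e \<and> route_load R q' e \<le> route_load R q e)))"

lemma dominatingI:
  assumes "\<And>k q q'. \<lbrakk> \<And>r. r \<in> R \<Longrightarrow> 0 \<le> q r; \<And>r. r \<in> R \<Longrightarrow> 0 \<le> q' r;
      \<And>r. \<lbrakk> r \<in> R; 0 < q r \<rbrakk> \<Longrightarrow> shortest k R r;
      sum q' R \<le> sum q R; 0 < sum q R \<rbrakk>
    \<Longrightarrow> \<exists>r. shortest k R r \<and>
          (\<forall>e\<in>set r. 0 < route_load R q e \<and> route_load R q' e \<le> route_load R q e)"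
  shows "dominating R"
  unfolding dominating_def using assms by blast

lemma dominatingE:
  assumes "dominating R"
    and "\<And>r. r \<in> R \<Longrightarrow> 0 \<le> q r" and "\<And>r. r \<in> R \<Longrightarrow> 0 \<le> q' r"
    and "\<And>r. \<lbrakk> r \<in> R; 0 < q r \<rbrakk> \<Longrightarrow> shortest k R r"
    and "sum q' R \<le> sum q R" and "0 < sum q R"
  obtains r where "shortest k R r"
    and "\<And>e. e \<in> set r \<Longrightarrow> 0 < route_load R q e \<and> route_load R q' e \<le> route_load R q e"
  using assms unfolding dominating_def by metis

lemma route_load_if:
  "finite R \<Longrightarrow> route_load R q e = (\<Sum>r\<in>R. if e \<in> set r then q r else 0)"
  by (simp add: route_load_def sum.inter_filter)

text \<open>With a single route the load on its edge is the whole flow, so the assumptions on the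
  totals are already the claim.\<close>

lemma dominating_single: "dominating {[e]}"
  by (rule dominatingI) (simp add: shortest_def route_load_if)

section \<open>Parallel connection: unions of edge-disjoint route sets\<close>

lemma route_load_parallel:
  assumes "\<And>b. b \<in> B \<Longrightarrow> e \<notin> set b"
  shows "route_load (A \<union> B) q e = route_load A q e"
proof -
  have "{r. r \<in> A \<union> B \<and> e \<in> set r} = {r. r \<in> A \<and> e \<in> set r}"
    using assms by auto
  then show ?thesis by (simp add: route_load_def)
qed

text \<open>The route is found inside \<open>A\<close> alone. It stays shortest in the union because
  \<open>A\<close> carries flow, so the minimal cost over \<open>A\<close> is the minimal cost
  overall; edge-disjointness keeps \<open>B\<close> from contributing to the loads on it.\<close>

lemma dominating_parallel_aux:
  assumes "dominating A"
    and disj: "\<And>a b. \<lbrakk> a \<in> A; b \<in> B \<rbrakk> \<Longrightarrow> set a \<inter> set b = {}"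
    and q: "\<And>r. r \<in> A \<union> B \<Longrightarrow> 0 \<le> q r" and q': "\<And>r. r \<in> A \<union> B \<Longrightarrow> 0 \<le> q' r"
    and eq: "\<And>r. \<lbrakk> r \<in> A \<union> B; 0 < q r \<rbrakk> \<Longrightarrow> shortest k (A \<union> B) r"
    and le: "sum q' A \<le> sum q A" and pos: "0 < sum q A"
  shows "\<exists>r. shortest k (A \<union> B) r \<and> (\<forall>e\<in>set r. 0 < route_load (A \<union> B) q e \<and>
    route_load (A \<union> B) q' e \<le> route_load (A \<union> B) q e)"
proof -
  have eqA: "shortest k A r" if "r \<in> A" "0 < q r" for r
    using eq[of r] that by (auto simp: shortest_def)
  obtain r where r: "shortest k A r"
    and ld: "\<And>e. e \<in> set r \<Longrightarrow> 0 < route_load A q e \<and> route_load A q' e \<le> route_load A q e"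
    using dominatingE[OF \<open>dominating A\<close>, of q q' k] q q' eqA le pos by (metis UnI1)
  \<comment> \<open>A route of \<open>A\<close> in use links the two minima: it is shortest in the
    union, and \<open>r\<close> costs no more.\<close>
  obtain a where a: "a \<in> A" "0 < q a"
    using pos by (meson not_less sum_nonpos)
  have "shortest k (A \<union> B) a" using a eq by auto
  moreover have "sum k (set r) \<le> sum k (set a)" "r \<in> A"
    using r a by (auto simp: shortest_def)
  ultimately have "shortest k (A \<union> B) r" by (force simp: shortest_def)
  moreover have "route_load (A \<union> B) p e = route_load A p e" if "e \<in> set r" for e p
    using that disj \<open>r \<in> A\<close> by (intro route_load_parallel) auto
  ultimately show ?thesis using ld by auto
qed

lemma dominating_parallel:
  assumes "finite A" "finite B" "dominating A" "dominating B"
    and disj: "\<And>a b. \<lbrakk> a \<in> A; b \<in> B \<rbrakk> \<Longrightarrow> set a \<inter> set b = {}"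
    and "[] \<notin> A"
  shows "dominating (A \<union> B)"
proof (rule dominatingI)
  fix k q q'
  assume q: "\<And>r. r \<in> A \<union> B \<Longrightarrow> 0 \<le> q r" and q': "\<And>r. r \<in> A \<union> B \<Longrightarrow> (0::real) \<le> q' r"
    and eq: "\<And>r. \<lbrakk> r \<in> A \<union> B; 0 < q r \<rbrakk> \<Longrightarrow> shortest k (A \<union> B) r"
    and le: "sum q' (A \<union> B) \<le> sum q (A \<union> B)" and pos: "0 < sum q (A \<union> B)"
  \<comment> \<open>A common route would be edge-disjoint from itself, hence empty.\<close>
  have "A \<inter> B = {}" using disj \<open>[] \<notin> A\<close> by force
  then have split: "sum p (A \<union> B) = sum p A + sum p B" for p :: "'a list \<Rightarrow> real"
    using assms by (simp add: sum.union_disjoint)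
  have nonneg: "0 \<le> sum q A" "0 \<le> sum q B" "0 \<le> sum q' A" "0 \<le> sum q' B"
    using q q' by (auto intro!: sum_nonneg)
  \<comment> \<open>If \<open>q\<close> puts no flow on \<open>A\<close>, then all of it is on
    \<open>B\<close>, which covers the total of \<open>q'\<close>. If \<open>q'\<close> exceeds
    \<open>q\<close> on \<open>A\<close>, then \<open>q\<close> exceeds \<open>q'\<close> on
    \<open>B\<close>, where it is therefore positive.\<close>
  consider "sum q' A \<le> sum q A" "0 < sum q A" | "sum q' B \<le> sum q B" "0 < sum q B"
    using le pos nonneg unfolding split by linarith
  then show "\<exists>r. shortest k (A \<union> B) r \<and> (\<forall>e\<in>set r. 0 < route_load (A \<union> B) q e \<and>
    route_load (A \<union> B) q' e \<le> route_load (A \<union> B) q e)"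
  proof cases
    case 1
    then show ?thesis using assms q q' eq by (intro dominating_parallel_aux) auto
  next
    case 2
    have "set b \<inter> set a = {}" if "a \<in> A" "b \<in> B" for a b using disj[OF that] by auto
    then have "\<exists>r. shortest k (B \<union> A) r \<and> (\<forall>e\<in>set r. 0 < route_load (B \<union> A) q e \<and>
      route_load (B \<union> A) q' e \<le> route_load (B \<union> A) q e)"
      using 2 assms(4) q q' eq
      by (intro dominating_parallel_aux) (auto simp: Un_commute[of B A])
    then show ?thesis by (simp add: Un_commute[of B A])
  qed
qed

section \<open>Series connection: concatenations of edge-disjoint routes\<close>

definition concatenations :: "'e list set \<Rightarrow> 'e list set \<Rightarrow> 'e list set" where
  "concatenations A B = (\<lambda>(a, b). a @ b) ` (A \<times> B)"

lemma concatenations_iff: "r \<in> concatenations A B \<longleftrightarrow> (\<exists>a\<in>A. \<exists>b\<in>B. r = a @ b)"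
  by (auto simp: concatenations_def)

lemma sum_concatenations:
  fixes f :: "'e list \<Rightarrow> real"
  assumes disj: "\<And>a b. \<lbrakk> a \<in> A; b \<in> B \<rbrakk> \<Longrightarrow> set a \<inter> set b = {}"
  shows "sum f (concatenations A B) = (\<Sum>a\<in>A. \<Sum>b\<in>B. f (a @ b))"
proof -
  have "inj_on (\<lambda>(a, b). a @ b) (A \<times> B)"
  proof (clarsimp simp: inj_on_def)
    fix a b a' b' assume *: "a \<in> A" "b \<in> B" "a' \<in> A" "b' \<in> B" "a @ b = a' @ b'"
    \<comment> \<open>Keeping only the edges that occur in \<open>A\<close> recovers the first
      factor of a concatenation, so the factorization is unique.\<close>
    have inA: "filter (\<lambda>e. \<exists>x\<in>A. e \<in> set x) x = x" if "x \<in> A" for x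
      using that by (auto simp: filter_id_conv)
    have inB: "filter (\<lambda>e. \<exists>x\<in>A. e \<in> set x) y = []" if "y \<in> B" for y
      using that disj by (auto simp: filter_empty_conv)
    have "a = a'"
      using arg_cong[OF *(5), of "filter (\<lambda>e. \<exists>x\<in>A. e \<in> set x)"]
      by (simp only: filter_append inA[OF *(1)] inA[OF *(3)] inB[OF *(2)] inB[OF *(4)] append_Nil2)
    then show "a = a' \<and> b = b'" using * by simp
  qed
  then show ?thesis
    unfolding concatenations_def
    by (simp add: sum.reindex sum.cartesian_product case_prod_unfold)
qed

text \<open>Each component carries the whole flow, so the comparison of totals passes unchanged to
  both induced strategies. Costs add and loads are those of the component, so the routes found in
  the two components can be joined.\<close>

lemma dominating_series:
  assumes "finite A" "finite B" "dominating A" "dominating B"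
    and disj: "\<And>a b. \<lbrakk> a \<in> A; b \<in> B \<rbrakk> \<Longrightarrow> set a \<inter> set b = {}"
  shows "dominating (concatenations A B)"
proof (rule dominatingI)
  let ?R = "concatenations A B"
  fix k q q'
  assume q: "\<And>r. r \<in> ?R \<Longrightarrow> 0 \<le> q r" and q': "\<And>r. r \<in> ?R \<Longrightarrow> (0::real) \<le> q' r"
    and eq: "\<And>r. \<lbrakk> r \<in> ?R; 0 < q r \<rbrakk> \<Longrightarrow> shortest k ?R r"
    and le: "sum q' ?R \<le> sum q ?R" and pos: "0 < sum q ?R"
  \<comment> \<open>the strategies induced on the two components\<close>
  define mA where "mA p a = (\<Sum>b\<in>B. p (a @ b))" for p :: "'a list \<Rightarrow> real" and a
  define mB where "mB p b = (\<Sum>a\<in>A. p (a @ b))" for p :: "'a list \<Rightarrow> real" and b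
  have fin: "finite ?R" using assms by (simp add: concatenations_def)
  have mem: "a @ b \<in> ?R" if "a \<in> A" "b \<in> B" for a b
    using that by (auto simp: concatenations_def)
  have cost: "sum k (set (a @ b)) = sum k (set a) + sum k (set b)" if "a \<in> A" "b \<in> B" for a b
    using disj[OF that] by (simp add: sum.union_disjoint)
  have sums: "sum p ?R = sum (mA p) A" "sum p ?R = sum (mB p) B" for p
    unfolding mA_def mB_def using disj
    by (simp_all add: sum_concatenations sum.swap[of _ A B])
  have loadA: "route_load ?R p e = route_load A (mA p) e" if "a \<in> A" "e \<in> set a" for p e a
  proof -
    have "e \<notin> set b" if "b \<in> B" for b using disj[OF \<open>a \<in> A\<close> that] \<open>e \<in> set a\<close> by auto
    then have "(\<Sum>x\<in>A. \<Sum>b\<in>B. if e \<in> set (x @ b) then p (x @ b) else 0)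
        = (\<Sum>x\<in>A. if e \<in> set x then mA p x else 0)"
      unfolding mA_def by (intro sum.cong refl) (auto intro: sum.cong)
    then show ?thesis using assms fin by (simp add: route_load_if sum_concatenations)
  qed
  have loadB: "route_load ?R p e = route_load B (mB p) e" if "b \<in> B" "e \<in> set b" for p e b
  proof -
    have "e \<notin> set a" if "a \<in> A" for a using disj[OF that \<open>b \<in> B\<close>] \<open>e \<in> set b\<close> by auto
    then have "(\<Sum>x\<in>B. \<Sum>a\<in>A. if e \<in> set (a @ x) then p (a @ x) else 0)
        = (\<Sum>x\<in>B. if e \<in> set x then mB p x else 0)"
      unfolding mB_def by (intro sum.cong refl) (auto intro: sum.cong)
    then show ?thesis using assms fin
      by (simp add: route_load_if sum_concatenations sum.swap[of _ A B])
  qed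
  have shortA: "shortest k A a" if "a \<in> A" "0 < mA q a" for a
  proof -
    obtain b where b: "b \<in> B" "0 < q (a @ b)"
      using \<open>0 < mA q a\<close> unfolding mA_def by (meson not_less sum_nonpos)
    then have s: "shortest k ?R (a @ b)" using eq mem that by blast
    \<comment> \<open>Exchange argument: keep the second half \<open>b\<close>, replace
      \<open>a\<close> by \<open>x\<close>, and cancel the cost of \<open>b\<close>.\<close>
    have "sum k (set a) \<le> sum k (set x)" if "x \<in> A" for x
      using s mem[OF that b(1)] cost[OF that b(1)] cost[OF \<open>a \<in> A\<close> b(1)]
      unfolding shortest_def by fastforce
    then show ?thesis using that by (simp add: shortest_def)
  qed
  have shortB: "shortest k B b" if "b \<in> B" "0 < mB q b" for b
  proof -
    obtain a where a: "a \<in> A" "0 < q (a @ b)"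
      using \<open>0 < mB q b\<close> unfolding mB_def by (meson not_less sum_nonpos)
    then have s: "shortest k ?R (a @ b)" using eq mem that by blast
    have "sum k (set b) \<le> sum k (set x)" if "x \<in> B" for x
      using s mem[OF a(1) that] cost[OF a(1) that] cost[OF a(1) \<open>b \<in> B\<close>]
      unfolding shortest_def by fastforce
    then show ?thesis using that by (simp add: shortest_def)
  qed
  have nonneg: "0 \<le> mA q a" "0 \<le> mA q' a" if "a \<in> A" for a
    using that q q' mem by (auto simp: mA_def intro!: sum_nonneg)
  have nonneg': "0 \<le> mB q b" "0 \<le> mB q' b" if "b \<in> B" for b
    using that q q' mem by (auto simp: mB_def intro!: sum_nonneg)
  obtain a where a: "shortest k A a"
    "\<And>e. e \<in> set a \<Longrightarrow> 0 < route_load A (mA q) e \<and> route_load A (mA q') e \<le> route_load A (mA q) e"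
    using dominatingE[OF \<open>dominating A\<close>, of "mA q" "mA q'" k]
      nonneg shortA le pos unfolding sums(1) by metis
  obtain b where b: "shortest k B b"
    "\<And>e. e \<in> set b \<Longrightarrow> 0 < route_load B (mB q) e \<and> route_load B (mB q') e \<le> route_load B (mB q) e"
    using dominatingE[OF \<open>dominating B\<close>, of "mB q" "mB q'" k]
      nonneg' shortB le pos unfolding sums(2) by metis
  have ab: "a \<in> A" "b \<in> B" using a b by (auto simp: shortest_def)
  have "sum k (set (a @ b)) \<le> sum k (set r)" if rR: "r \<in> ?R" for r
  proof -
    obtain x y where r: "r = x @ y" "x \<in> A" "y \<in> B"
      using rR unfolding concatenations_iff by blast
    have "sum k (set a) \<le> sum k (set x)" "sum k (set b) \<le> sum k (set y)"
      using a(1) b(1) r by (auto simp: shortest_def)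
    then show ?thesis using cost[OF ab] cost[OF r(2,3)] r(1) by simp
  qed
  then have "shortest k ?R (a @ b)" using mem[OF ab] by (simp add: shortest_def)
  moreover have "0 < route_load ?R q e \<and> route_load ?R q' e \<le> route_load ?R q e"
    if "e \<in> set (a @ b)" for e
    using that a(2) b(2) loadA[OF ab(1)] loadB[OF ab(2)] by auto
  ultimately show "\<exists>r. shortest k ?R r \<and>
    (\<forall>e\<in>set r. 0 < route_load ?R q e \<and> route_load ?R q' e \<le> route_load ?R q e)" by blast
qed

subsection \<open>Routes of series-parallel networks\<close>

lemma route_iff:
  "r \<in> routes G u v \<longleftrightarrow> u \<in> verts G \<and> set r \<subseteq> arcs G \<and> pre_digraph.cas G u r v \<and>
     distinct (pre_digraph.awalk_verts G u r)"
  by (auto simp: routes_def pre_digraph.apath_def pre_digraph.awalk_def)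

text \<open>Discarding edges and vertices on no route loses no route, so facts about the recursively
  built network transfer to \<open>G\<close>.\<close>

lemma routes_route_subnetwork: "routes (route_subnetwork G u v) u v = routes G u v"
proof -
  let ?S = "route_subnetwork G u v"
  have c: "compatible ?S G" by (simp add: compatible_def route_subnetwork_def)
  have u: "u \<in> verts ?S" if "r \<in> routes G u v" for r
    using that by (cases r) (auto simp: route_subnetwork_def pre_digraph.awalk_verts.simps
      route_iff pre_digraph.cas.simps intro!: bexI[of _ r])
  have "u \<in> verts G" if "u \<in> verts ?S"
    using that by (auto simp: route_subnetwork_def route_iff)
  moreover have "arcs ?S \<subseteq> arcs G" by (auto simp: route_subnetwork_def route_iff)
  then have "set r \<subseteq> arcs G" if "set r \<subseteq> arcs ?S" for r
    using that by blast
  moreover have "set r \<subseteq> arcs ?S" if "r \<in> routes G u v" for r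
    using that by (auto simp: route_subnetwork_def)
  moreover have "r \<in> routes ?S u v \<longleftrightarrow> u \<in> verts ?S \<and> set r \<subseteq> arcs ?S \<and>
      pre_digraph.cas G u r v \<and> distinct (pre_digraph.awalk_verts G u r)" for r
    by (simp add: route_iff compatible_cas[OF c] compatible_awalk_verts[OF c])
  ultimately have "r \<in> routes ?S u v \<longleftrightarrow> r \<in> routes G u v" for r
    using u[of r] route_iff[of r G u v] by metis
  then show ?thesis by blast
qed

text \<open>Confines walks in a connection: as no edge enters the origin or leaves the destination
  of a component, a walk cannot slip back through a shared terminal.\<close>

lemma sp_network_wf:
  assumes "sp_network G u v"
  shows "wf_digraph G \<and> u \<noteq> v \<and> u \<in> verts G \<and> v \<in> verts G \<and>
    (\<forall>e\<in>arcs G. head G e \<noteq> u \<and> tail G e \<noteq> v)"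
  using assms
proof (induction rule: sp_network.induct)
  case (single u v G e)
  then show ?case by (auto simp: wf_digraph_def)
next
  case (series G u m H v)
  have wf: "wf_digraph (union G H)" using series by (intro wellformed_union) auto
  have "u \<notin> verts H" "v \<notin> verts G" using series by auto
  then have "head H e \<noteq> u" if "e \<in> arcs H" for e
    using that series wf_digraph.head_in_verts by metis
  moreover have "tail G e \<noteq> v" if "e \<in> arcs G" for e
    using \<open>v \<notin> verts G\<close> that series wf_digraph.tail_in_verts by metis
  ultimately show ?case
    using series wf \<open>u \<notin> verts H\<close> by (auto simp: union_def compatible_def)
next
  case (parallel G u v H)
  have "wf_digraph (union G H)" using parallel by (intro wellformed_union) auto
  then show ?case using parallel by (auto simp: union_def compatible_def)
qed

lemma sp_networkD:
  assumes "sp_network G u v"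
  shows "wf_digraph G" "u \<noteq> v" "u \<in> verts G" "v \<in> verts G"
    "\<And>e. e \<in> arcs G \<Longrightarrow> head G e \<noteq> u" "\<And>e. e \<in> arcs G \<Longrightarrow> tail G e \<noteq> v"
    "\<And>e. e \<in> arcs G \<Longrightarrow> head G e \<in> verts G" "\<And>e. e \<in> arcs G \<Longrightarrow> tail G e \<in> verts G"
  using sp_network_wf[OF assms] by (auto simp: wf_digraph_def)

lemma routes_single:
  assumes "u \<noteq> v" "verts G = {u, v}" "arcs G = {e}" "tail G e = u" "head G e = v"
  shows "routes G u v = {[e]}"
proof -
  have "r = [e]" if r: "r \<in> routes G u v" for r
  proof (cases r)
    case Nil
    then show ?thesis using r assms by (auto simp: route_iff pre_digraph.cas.simps)
  next
    case (Cons x r')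
    then show ?thesis
      using r assms by (cases r') (auto simp: route_iff pre_digraph.cas.simps)
  qed
  moreover have "[e] \<in> routes G u v"
    using assms
    by (auto simp: route_iff pre_digraph.cas.simps pre_digraph.awalk_verts.simps)
  ultimately show ?thesis by blast
qed

text \<open>The components meet only in \<open>m\<close>, no edge of \<open>G\<close> leaves
  \<open>m\<close>, and no edge of \<open>H\<close> enters it. A route therefore crosses from
  \<open>G\<close> to \<open>H\<close> exactly once, at \<open>m\<close>.\<close>

lemma routes_series:
  assumes G: "sp_network G u m" and H: "sp_network H m v" and comp: "compatible G H"
    and vs: "verts G \<inter> verts H = {m}"
  shows "routes (union G H) u v = concatenations (routes G u m) (routes H m v)"
proof -
  let ?U = "union G H"
  note GD = sp_networkD[OF G] and HD = sp_networkD[OF H]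
  have th: "tail H = tail G" "head H = head G" "tail ?U = tail G" "head ?U = head G"
    "arcs ?U = arcs G \<union> arcs H" "verts ?U = verts G \<union> verts H"
    using comp by (auto simp: compatible_def union_def)
  have cH: "compatible ?U H" and cG: "compatible ?U G"
    using comp by (auto simp: compatible_def union_def)
  interpret U: wf_digraph ?U
    using GD(1) HD(1) comp by (rule wellformed_union)
  have vm: "x = m" if "x \<in> verts G" "x \<in> verts H" for x using vs that by blast
  \<comment> \<open>From a vertex of \<open>H\<close> no edge of \<open>G\<close> can be taken: its
    tail would be shared, hence \<open>m\<close>, the destination of \<open>G\<close>.\<close>
  have inH: "set p \<subseteq> arcs H"
    if "x \<in> verts H" "U.cas x p v" "set p \<subseteq> arcs G \<union> arcs H" for x p
    using that
  proof (induction p arbitrary: x)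
    case (Cons e p)
    have "e \<notin> arcs G"
      using Cons.prems GD(6,8)[of e] vm[of x] by (auto simp: th)
    then have "e \<in> arcs H" using Cons.prems by auto
    then show ?case using Cons HD(7)[of e] by (auto simp: th)
  qed simp
  have split: "\<exists>a b. p = a @ b \<and> set a \<subseteq> arcs G \<and> set b \<subseteq> arcs H \<and> U.cas x a m \<and> U.cas m b v"
    if "x \<in> verts G" "U.cas x p v" "set p \<subseteq> arcs G \<union> arcs H" for x p
    using that
  proof (induction p arbitrary: x)
    case Nil
    \<comment> \<open>An empty walk would place \<open>v\<close> in both components, forcing
      \<open>v = m\<close>.\<close>
    then show ?case using vm[of v] HD by auto
  next
    case (Cons e p)
    show ?case
    proof (cases "x = m")
      case True
      then have "set (e # p) \<subseteq> arcs H" using inH[of m "e # p"] Cons.prems HD by blast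
      then show ?thesis using True Cons.prems
        by (intro exI[of _ "[]"] exI[of _ "e # p"]) auto
    next
      case False
      then have "e \<in> arcs G" using Cons.prems HD(8)[of e] vm[of x] by (auto simp: th)
      moreover from this obtain a b where "p = a @ b" "set a \<subseteq> arcs G" "set b \<subseteq> arcs H"
        "U.cas (head G e) a m" "U.cas m b v"
        using Cons GD(7)[of e] by (auto simp: th) blast
      ultimately show ?thesis using Cons.prems
        by (intro exI[of _ "e # a"] exI[of _ b]) (auto simp: th)
    qed
  qed
  \<comment> \<open>Routes of a component are the simple paths of the union confined to its arcs, so
    all path reasoning can take place in the union.\<close>
  have Gr: "r \<in> routes G u m \<longleftrightarrow> U.apath u r m \<and> set r \<subseteq> arcs G" for r
    using GD by (auto simp: route_iff U.apath_def U.awalk_def th compatible_cas[OF cG]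
      compatible_awalk_verts[OF cG])
  have Hr: "r \<in> routes H m v \<longleftrightarrow> U.apath m r v \<and> set r \<subseteq> arcs H" for r
    using HD by (auto simp: route_iff U.apath_def U.awalk_def th compatible_cas[OF cH]
      compatible_awalk_verts[OF cH])
  show ?thesis
  proof (intro equalityI subsetI)
    fix p assume "p \<in> routes ?U u v"
    then have p: "U.apath u p v" by (simp add: routes_def)
    then obtain a b where ab: "p = a @ b" "set a \<subseteq> arcs G" "set b \<subseteq> arcs H"
      "U.cas u a m" "U.cas m b v"
      using split[of u p] GD by (auto simp: U.apath_def U.awalk_def th)
    then have "a \<in> routes G u m" "b \<in> routes H m v"
      using p unfolding Gr Hr by (auto simp: U.apath_append_iff U.awlast_if_cas)
    then show "p \<in> concatenations (routes G u m) (routes H m v)"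
      using ab by (auto simp: concatenations_def)
  next
    fix p assume "p \<in> concatenations (routes G u m) (routes H m v)"
    then obtain a b where p: "p = a @ b" and a: "U.apath u a m" "set a \<subseteq> arcs G"
      and b: "U.apath m b v" "set b \<subseteq> arcs H"
      by (auto simp: concatenations_def Gr Hr)
    have cas: "U.cas u a m" "U.cas m b v" using a b by (auto simp: U.apath_def)
    have "set (U.awalk_verts u a) \<subseteq> verts G"
      using a GD by (auto simp: U.set_awalk_verts_cas[OF cas(1)] th)
    \<comment> \<open>\<open>tl\<close> drops the start \<open>m\<close> of the second path. It
      cannot recur, since no edge of \<open>H\<close> enters \<open>m\<close>.\<close>
    moreover have "set (tl (U.awalk_verts m b)) \<subseteq> verts H - {m}"
      using b HD by (auto simp: U.awalk_verts_conv'[OF cas(2)] th)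
    ultimately have "U.apath u p v"
      using a b vs by (auto simp: p U.apath_append_iff U.awlast_if_cas[OF cas(1)])
    then show "p \<in> routes ?U u v" by (simp add: routes_def)
  qed
qed

text \<open>The first edge decides the component: past \<open>u\<close>, the only shared vertex
  still reachable is \<open>v\<close>, which no edge leaves.\<close>

lemma routes_parallel:
  assumes G: "sp_network G u v" and H: "sp_network H u v" and comp: "compatible G H"
    and vs: "verts G \<inter> verts H = {u, v}"
  shows "routes (union G H) u v = routes G u v \<union> routes H u v"
proof -
  let ?U = "union G H"
  note GD = sp_networkD[OF G] and HD = sp_networkD[OF H]
  have th: "tail H = tail G" "head H = head G" "tail ?U = tail G" "head ?U = head G"
    "arcs ?U = arcs G \<union> arcs H" "verts ?U = verts G \<union> verts H"
    using comp by (auto simp: compatible_def union_def)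
  have cH: "compatible ?U H" and cG: "compatible ?U G"
    using comp by (auto simp: compatible_def union_def)
  interpret U: wf_digraph ?U
    using GD(1) HD(1) comp by (rule wellformed_union)
  have vuv: "x = u \<or> x = v" if "x \<in> verts G" "x \<in> verts H" for x using vs that by blast
  \<comment> \<open>The condition \<open>x \<noteq> u\<close> survives each step because no edge of
    \<open>G\<close> enters \<open>u\<close>.\<close>
  have inG: "set p \<subseteq> arcs G"
    if "x \<in> verts G" "x \<noteq> u" "U.cas x p v" "set p \<subseteq> arcs G \<union> arcs H" for x p
    using that
  proof (induction p arbitrary: x)
    case (Cons e p)
    have "e \<notin> arcs H" using Cons.prems HD(6,8)[of e] vuv[of x] by (auto simp: th)
    then show ?case using Cons GD(5,7)[of e] by (auto simp: th)
  qed simp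
  have inH: "set p \<subseteq> arcs H"
    if "x \<in> verts H" "x \<noteq> u" "U.cas x p v" "set p \<subseteq> arcs G \<union> arcs H" for x p
    using that
  proof (induction p arbitrary: x)
    case (Cons e p)
    have "e \<notin> arcs G" using Cons.prems GD(6,8)[of e] vuv[of x] by (auto simp: th)
    then show ?case using Cons HD(5,7)[of e] by (auto simp: th)
  qed simp
  have Ur: "set p \<subseteq> arcs G \<or> set p \<subseteq> arcs H"
    if "U.cas u p v" "set p \<subseteq> arcs G \<union> arcs H" for p
  proof (cases p)
    case (Cons e p')
    then show ?thesis
      using that inG[of "head G e" p'] inH[of "head G e" p'] GD(5,7)[of e] HD(5,7)[of e]
      by (auto simp: th)
  qed simp
  have "r \<in> routes ?U u v \<longleftrightarrow> r \<in> routes G u v \<or> r \<in> routes H u v" for r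
    using Ur[of r] GD(3) HD(3)
    by (auto simp: route_iff th compatible_cas[OF cG, symmetric]
      compatible_awalk_verts[OF cG, symmetric] compatible_cas[OF cH, symmetric]
      compatible_awalk_verts[OF cH, symmetric])
  then show ?thesis by blast
qed

text \<open>Induction over the construction; finiteness is carried along because the closure lemmas
  require it.\<close>

lemma sp_network_dominating:
  assumes "sp_network G u v"
  shows "finite (routes G u v) \<and> dominating (routes G u v)"
  using assms
proof (induction rule: sp_network.induct)
  case (single u v G e)
  then show ?case by (simp add: routes_single dominating_single)
next
  case (series G u m H v)
  have "set a \<inter> set b = {}" if "a \<in> routes G u m" "b \<in> routes H m v" for a b
    using that series.hyps by (auto simp: route_iff)
  then have "dominating (concatenations (routes G u m) (routes H m v))"
    using series.IH by (intro dominating_series) auto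
  then show ?case
    using series.IH by (simp add: routes_series[OF series.hyps(1-4)] concatenations_def)
next
  case (parallel G u v H)
  have "set a \<inter> set b = {}" if "a \<in> routes G u v" "b \<in> routes H u v" for a b
    using that parallel.hyps by (auto simp: route_iff)
  moreover have "[] \<notin> routes G u v"
    using sp_networkD(2)[OF parallel.hyps(1)] by (simp add: route_iff pre_digraph.cas.simps)
  ultimately have "dominating (routes G u v \<union> routes H u v)"
    using parallel.IH by (intro dominating_parallel) auto
  then show ?case
    using parallel.IH by (simp add: routes_parallel[OF parallel.hyps(1-4)])
qed

subsection \<open>Equilibrium costs\<close>

lemma load_route_load: "load G u v q e = route_load (routes G u v) q e"
  by (simp add: load_def route_load_def)

text \<open>Double counting of edge-route incidences. Routes without flow contribute zero, so only
  those in use have to cost \<open>l\<close>.\<close>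

lemma sum_load_cost:
  assumes "finite R" "finite A" "\<And>r. r \<in> R \<Longrightarrow> set r \<subseteq> A"
    and "\<And>r. r \<in> R \<Longrightarrow> 0 \<le> q r" and "\<And>r. \<lbrakk> r \<in> R; 0 < q r \<rbrakk> \<Longrightarrow> sum k (set r) = l"
  shows "(\<Sum>e\<in>A. route_load R q e * k e) = sum q R * l"
proof -
  have "(\<Sum>e\<in>A. route_load R q e * k e) = (\<Sum>r\<in>R. \<Sum>e\<in>A. (if e \<in> set r then q r else 0) * k e)"
    using assms(1) by (simp add: route_load_if sum_distrib_right sum.swap[of _ R A])
  also have "\<dots> = (\<Sum>r\<in>R. q r * l)"
  proof (intro sum.cong refl)
    fix r assume r: "r \<in> R"
    have "(\<Sum>e\<in>A. (if e \<in> set r then q r else 0) * k e) = (\<Sum>e\<in>A. if e \<in> set r then q r * k e else 0)"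
      by (intro sum.cong) auto
    also have "\<dots> = (\<Sum>e\<in>set r. q r * k e)"
      using assms(2) assms(3)[OF r] by (simp add: sum.If_cases Int_absorb1)
    also have "\<dots> = q r * sum k (set r)" by (simp add: sum_distrib_left)
    also have "\<dots> = q r * l" using assms(4)[OF r] assms(5)[OF r] by (cases "q r = 0") auto
    finally show "(\<Sum>e\<in>A. (if e \<in> set r then q r else 0) * k e) = q r * l" .
  qed
  finally show ?thesis by (simp add: sum_distrib_right)
qed

text \<open>Taking the expectation edge by edge gives the form \<open>sum k (set r)\<close> that
  \<open>shortest\<close> works with.\<close>

lemma expected_route_cost_sum:
  "expected_route_cost G u v S c \<theta> q r = (\<Sum>e\<in>set r. \<Sum>s\<in>S. \<theta> s * c e s (load G u v q e))"
  by (simp add: expected_route_cost_def route_cost_def sum_distrib_left sum.swap[of _ S])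

lemma wardrop_equilibrium_shortest:
  assumes "wardrop_equilibrium G u v D S c \<theta> q" and "finite (routes G u v)"
    and "r \<in> routes G u v" and "0 < q r"
  shows "shortest (\<lambda>e. \<Sum>s\<in>S. \<theta> s * c e s (load G u v q e)) (routes G u v) r"
proof -
  have "expected_route_cost G u v S c \<theta> q r = Min (expected_route_cost G u v S c \<theta> q ` routes G u v)"
    using assms by (auto simp: wardrop_equilibrium_def)
  then have "expected_route_cost G u v S c \<theta> q r \<le> expected_route_cost G u v S c \<theta> q r'"
    if "r' \<in> routes G u v" for r'
    using assms that by simp
  then show ?thesis using assms unfolding shortest_def expected_route_cost_sum by simp
qed

lemma shortest_unique: "shortest k R r \<Longrightarrow> shortest k R r' \<Longrightarrow> sum k (set r) = sum k (set r')"
  by (force simp: shortest_def intro: order_antisym)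

section \<open>Comparison of the two equilibria\<close>

theorem proposition1:
  fixes G :: "('v, 'e) pre_digraph" and orig dest :: 'v
    and S :: "'s set" and s0 :: 's
    and c :: "'e \<Rightarrow> 's \<Rightarrow> real \<Rightarrow> real"
    and D \<alpha> :: real
    and \<theta> :: "'s \<Rightarrow> real" and w wstar :: "'e \<Rightarrow> real"
  assumes "fin_digraph G" and "orig \<noteq> dest" and "routes G orig dest \<noteq> {}"
    and "finite S" and "s0 \<in> S" and "D > 0" and "\<alpha> > 0"
    and "\<And>e s. \<lbrakk> e \<in> arcs G; s \<in> S \<rbrakk> \<Longrightarrow> continuous_on {0..} (c e s)"
    and "\<And>e s. \<lbrakk> e \<in> arcs G; s \<in> S \<rbrakk> \<Longrightarrow> strict_mono_on {0..} (c e s)"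
    and "\<And>e s x. \<lbrakk> e \<in> arcs G; s \<in> S; 0 < x \<rbrakk>
           \<Longrightarrow> \<exists>d. (c e s has_real_derivative d) (at x) \<and> \<alpha> \<le> d"
    and "series_parallel G orig dest"
    and "rest_point G orig dest D S c s0 \<theta> w"
    and "equilibrium_load G orig dest D S c (certain s0) wstar"
  shows "total_cost G c s0 w \<ge> total_cost G c s0 wstar"
proof -
  let ?R = "routes G orig dest"
  let ?l = "route_load ?R"
  interpret fin_digraph G by fact
  have finR: "finite ?R" using apaths_finite by (simp add: routes_def)
  have arcsR: "set r \<subseteq> arcs G" if "r \<in> ?R" for r using that by (simp add: route_iff)
  have dom: "dominating ?R"
    using sp_network_dominating \<open>series_parallel G orig dest\<close>
    by (metis series_parallel_def routes_route_subnetwork)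
  obtain q where q: "wardrop_equilibrium G orig dest D S c \<theta> q" "\<And>e. e \<in> arcs G \<Longrightarrow> w e = ?l q e"
    using \<open>rest_point _ _ _ _ _ _ _ _ _\<close>
    unfolding rest_point_def equilibrium_load_def load_route_load by blast
  obtain q' where q': "wardrop_equilibrium G orig dest D S c (certain s0) q'"
    "\<And>e. e \<in> arcs G \<Longrightarrow> wstar e = ?l q' e"
    using \<open>equilibrium_load G orig dest D S c (certain s0) wstar\<close>
    unfolding equilibrium_load_def load_route_load by blast
  have nonneg: "0 \<le> q r" "0 \<le> q' r" if "r \<in> ?R" for r
    using q(1) q'(1) that by (auto simp: wardrop_equilibrium_def strategies_def)
  have tot: "sum q ?R = D" "sum q' ?R = D"
    using q(1) q'(1) by (auto simp: wardrop_equilibrium_def strategies_def)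
  have load_nonneg: "0 \<le> ?l q e" "0 \<le> ?l q' e" for e
    unfolding route_load_def using nonneg by (auto intro: sum_nonneg)
  define k where "k e = (\<Sum>s\<in>S. \<theta> s * c e s (?l q e))" for e
  define k' where "k' e = c e s0 (?l q' e)" for e
  have short: "shortest k ?R r" if "r \<in> ?R" "0 < q r" for r
    using wardrop_equilibrium_shortest[OF q(1) finR that]
    unfolding load_route_load k_def by simp
  have k'_eq: "k' e = (\<Sum>s\<in>S. certain s0 s * c e s (?l q' e))" for e
  proof -
    have "(\<Sum>s\<in>S. certain s0 s * c e s (?l q' e)) = (\<Sum>s\<in>S. if s = s0 then c e s0 (?l q' e) else 0)"
      by (intro sum.cong) (auto simp: certain_def)
    then show ?thesis using assms(4,5) by (simp add: k'_def)
  qed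
  have short': "shortest k' ?R r" if "r \<in> ?R" "0 < q' r" for r
    using wardrop_equilibrium_shortest[OF q'(1) finR that]
    unfolding load_route_load k'_eq[abs_def] by simp
  have k_true: "k e = c e s0 (?l q e)" if e: "e \<in> arcs G" "0 < ?l q e" for e
  proof -
    have "\<theta> s = 0 \<or> c e s (w e) = c e s0 (w e)" if "s \<in> S" "0 < w e" for s
      using assms(12) e(1) that unfolding rest_point_def distinguished_states_def by blast
    then have "\<theta> s * c e s (?l q e) = \<theta> s * c e s0 (?l q e)" if "s \<in> S" for s
      using that e q(2)[OF e(1)] by force
    then have "k e = (\<Sum>s\<in>S. \<theta> s) * c e s0 (?l q e)" by (auto simp: k_def sum_distrib_right intro: sum.cong)
    then show ?thesis
      using \<open>rest_point _ _ _ _ _ _ _ _ _\<close> by (simp add: rest_point_def beliefs_def)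
  qed
  obtain r where r: "shortest k ?R r"
    and dominates: "\<And>e. e \<in> set r \<Longrightarrow> 0 < ?l q e \<and> ?l q' e \<le> ?l q e"
    using dominatingE[OF dom, of q q' k] nonneg short tot \<open>D > 0\<close> by (metis order_refl)
  obtain r' where r': "r' \<in> ?R" "0 < q' r'"
    using tot \<open>D > 0\<close> by (metis not_less sum_nonpos)
  have rR: "r \<in> ?R" using r by (simp add: shortest_def)
  have "total_cost G c s0 wstar = (\<Sum>e\<in>arcs G. ?l q' e * k' e)"
    unfolding total_cost_def by (intro sum.cong) (auto simp: k'_def q'(2))
  also have "\<dots> = D * sum k' (set r')"
    unfolding tot(2)[symmetric]
    by (intro sum_load_cost finR finite_arcs arcsR nonneg)
      (auto intro: shortest_unique short' r')
  \<comment> \<open>This inequality and the next compare route costs and are substituted under the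
    factor \<open>D\<close>; its monotonicity comes from \<open>D > 0\<close> at the end.\<close>
  also have "sum k' (set r') \<le> sum k' (set r)"
    using short'[OF r'] rR by (simp add: shortest_def)
  also have "\<dots> \<le> sum k (set r)"
  proof (intro sum_mono)
    fix e assume e: "e \<in> set r"
    then have "e \<in> arcs G" using arcsR[OF rR] by auto
    then have "mono_on {0..} (c e s0)" using assms(5,9) strict_mono_on_imp_mono_on by blast
    then show "k' e \<le> k e"
      using dominates[OF e] load_nonneg \<open>e \<in> arcs G\<close> by (auto simp: k_true k'_def mono_on_def)
  qed
  \<comment> \<open>Even if \<open>r\<close> carries no flow, it costs the same as every route in
    use, all of them being shortest.\<close>
  also have "D * sum k (set r) = (\<Sum>e\<in>arcs G. ?l q e * k e)"
    unfolding tot(1)[symmetric]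
    by (intro sum_load_cost[symmetric] finR finite_arcs arcsR nonneg)
      (auto intro: shortest_unique short r)
  also have "\<dots> = total_cost G c s0 w"
    unfolding total_cost_def
  proof (intro sum.cong refl)
    fix e assume "e \<in> arcs G"
    \<comment> \<open>Edges with zero load drop out of both sides, so a wrong expected cost there is
      harmless.\<close>
    then show "?l q e * k e = w e * c e s0 (w e)"
      using k_true[of e] load_nonneg(1)[of e] q(2)[of e] by (cases "?l q e = 0") auto
  qed
  finally show ?thesis using \<open>D > 0\<close> by simp
qed

end
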